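(* In any ordered divisible abelian group (possibly with additional symbols in its language), if the scheme $\mathtt{DCI}$ holds then the scheme $\mathtt{DCI}_1$ holds too. The converse fails: in the ordered field of rational numbers $\mathbb{Q}$ the scheme $\mathtt{DCI}_1$ holds but $\mathtt{DCI}$ does not.
   Context: Formulas are first-order formulas in the language of the structure (which contains $<,0,+$; for $\mathbb{Q}$ it is the language of ordered fields); a scheme "holds" in a structure if every instance (with any further free variables of $\varphi$ read universally, as parameters) is true in it. The scheme $\mathtt{DCI}$ consists of all sentences $$\exists x\,\forall y\!<\!x\,\varphi(y)\;\wedge\;\forall x\big[\forall y\!<\!x\,\varphi(y)\rightarrow\exists z\!>\!x\,\forall y\!<\!z\,\varphi(y)\big]\longrightarrow\forall x\,\varphi(x).$$ The scheme $\mathtt{DCI}_1$ consists of all sentences $$\exists x\,\forall y\!\leqslant\!x\,\varphi(y)\;\wedge\;\exists\epsilon\!>\!0\,\forall x\big(\varphi(x)\rightarrow\forall y\,[x\!\leqslant\!y\!\leqslant\!x+\epsilon\rightarrow\varphi(y)]\big)\longrightarrow\forall x\,\varphi(x).$$ *)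

theory Defs
  imports Complex_Main
begin

text \<open>
  First-order logic over a language that contains \<open><\<close>, \<open>0\<close>, \<open>+\<close> and equality, together with
  arbitrary additional function symbols (constants have arity 0) and relation symbols.
  The additional symbols are given by sets of pairs (symbol, arity), which may be empty.
\<close>

record ('f, 'r) language =
  fun_syms :: "('f \<times> nat) set"
  rel_syms :: "('r \<times> nat) set"

text \<open>Variables are de Bruijn indices: \<open>Var k\<close> refers to the \<open>k\<close>-th enclosing quantifier,
  counted from the inside starting with 0; indices beyond the quantifiers are free variables.\<close>

datatype 'f tm =
    Var nat
  | Zero
  | Plus "'f tm" "'f tm"
  | Fn 'f "'f tm list"

datatype ('f, 'r) fm =
    Eq "'f tm" "'f tm"
  | Less "'f tm" "'f tm"
  | Rel 'r "'f tm list"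
  | Neg "('f, 'r) fm"
  | Conj "('f, 'r) fm" "('f, 'r) fm"
  | Disj "('f, 'r) fm" "('f, 'r) fm"
  | Imp "('f, 'r) fm" "('f, 'r) fm"
  | All "('f, 'r) fm"
  | Ex "('f, 'r) fm"

primrec tm_in :: "('f, 'r, 'z) language_scheme \<Rightarrow> 'f tm \<Rightarrow> bool" where
  "tm_in L (Var k) \<longleftrightarrow> True"
| "tm_in L Zero \<longleftrightarrow> True"
| "tm_in L (Plus s t) \<longleftrightarrow> tm_in L s \<and> tm_in L t"
| "tm_in L (Fn f ts) \<longleftrightarrow> (f, length ts) \<in> fun_syms L \<and> list_all (tm_in L) ts"

primrec fm_in :: "('f, 'r, 'z) language_scheme \<Rightarrow> ('f, 'r) fm \<Rightarrow> bool" where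
  "fm_in L (Eq s t) \<longleftrightarrow> tm_in L s \<and> tm_in L t"
| "fm_in L (Less s t) \<longleftrightarrow> tm_in L s \<and> tm_in L t"
| "fm_in L (Rel r ts) \<longleftrightarrow> (r, length ts) \<in> rel_syms L \<and> list_all (tm_in L) ts"
| "fm_in L (Neg p) \<longleftrightarrow> fm_in L p"
| "fm_in L (Conj p q) \<longleftrightarrow> fm_in L p \<and> fm_in L q"
| "fm_in L (Disj p q) \<longleftrightarrow> fm_in L p \<and> fm_in L q"
| "fm_in L (Imp p q) \<longleftrightarrow> fm_in L p \<and> fm_in L q"
| "fm_in L (All p) \<longleftrightarrow> fm_in L p"
| "fm_in L (Ex p) \<longleftrightarrow> fm_in L p"

text \<open>
  The universe of a structure is the type \<open>'a\<close>, and \<open><\<close>, \<open>0\<close>, \<open>+\<close> and equality are those of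
  \<open>'a\<close>; the record interprets the additional symbols. Values at argument lists whose length is
  not an arity of the symbol in the language are irrelevant.
\<close>

record ('f, 'r, 'a) interp =
  fun_of :: "'f \<Rightarrow> 'a list \<Rightarrow> 'a"
  rel_of :: "'r \<Rightarrow> 'a list \<Rightarrow> bool"

primrec tm_val ::
  "('f, 'r, 'a::{zero,plus}, 'z) interp_scheme \<Rightarrow> (nat \<Rightarrow> 'a) \<Rightarrow> 'f tm \<Rightarrow> 'a" where
  "tm_val M e (Var k) = e k"
| "tm_val M e Zero = 0"
| "tm_val M e (Plus s t) = tm_val M e s + tm_val M e t"
| "tm_val M e (Fn f ts) = fun_of M f (map (tm_val M e) ts)"

primrec sat ::
  "('f, 'r, 'a::{zero,plus,ord}, 'z) interp_scheme \<Rightarrow> (nat \<Rightarrow> 'a) \<Rightarrow> ('f, 'r) fm \<Rightarrow> bool" where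
  "sat M e (Eq s t) \<longleftrightarrow> tm_val M e s = tm_val M e t"
| "sat M e (Less s t) \<longleftrightarrow> tm_val M e s < tm_val M e t"
| "sat M e (Rel r ts) \<longleftrightarrow> rel_of M r (map (tm_val M e) ts)"
| "sat M e (Neg p) \<longleftrightarrow> \<not> sat M e p"
| "sat M e (Conj p q) \<longleftrightarrow> sat M e p \<and> sat M e q"
| "sat M e (Disj p q) \<longleftrightarrow> sat M e p \<or> sat M e q"
| "sat M e (Imp p q) \<longleftrightarrow> (sat M e p \<longrightarrow> sat M e q)"
| "sat M e (All p) \<longleftrightarrow> (\<forall>a. sat M (case_nat a e) p)"
| "sat M e (Ex p) \<longleftrightarrow> (\<exists>a. sat M (case_nat a e) p)"

text \<open>Quantifying over all assignments reads the remaining free variables universally.\<close>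

definition holds ::
  "('f, 'r, 'a::{zero,plus,ord}, 'z) interp_scheme \<Rightarrow> ('f, 'r) fm set \<Rightarrow> bool" where
  "holds M S \<longleftrightarrow> (\<forall>p\<in>S. \<forall>e. sat M e p)"

primrec rename_tm :: "(nat \<Rightarrow> nat) \<Rightarrow> 'f tm \<Rightarrow> 'f tm" where
  "rename_tm g (Var k) = Var (g k)"
| "rename_tm g Zero = Zero"
| "rename_tm g (Plus s t) = Plus (rename_tm g s) (rename_tm g t)"
| "rename_tm g (Fn f ts) = Fn f (map (rename_tm g) ts)"

text \<open>Under a quantifier the bound index 0 is left alone and the others are renamed by \<open>g\<close>.\<close>

abbreviation lift_ren :: "(nat \<Rightarrow> nat) \<Rightarrow> nat \<Rightarrow> nat" where
  "lift_ren g \<equiv> case_nat 0 (\<lambda>k. Suc (g k))"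

primrec rename :: "(nat \<Rightarrow> nat) \<Rightarrow> ('f, 'r) fm \<Rightarrow> ('f, 'r) fm" where
  "rename g (Eq s t) = Eq (rename_tm g s) (rename_tm g t)"
| "rename g (Less s t) = Less (rename_tm g s) (rename_tm g t)"
| "rename g (Rel r ts) = Rel r (map (rename_tm g) ts)"
| "rename g (Neg p) = Neg (rename g p)"
| "rename g (Conj p q) = Conj (rename g p) (rename g q)"
| "rename g (Disj p q) = Disj (rename g p) (rename g q)"
| "rename g (Imp p q) = Imp (rename g p) (rename g q)"
| "rename g (All p) = All (rename (lift_ren g) p)"
| "rename g (Ex p) = Ex (rename (lift_ren g) p)"

abbreviation Leq :: "'f tm \<Rightarrow> 'f tm \<Rightarrow> ('f, 'r) fm" where
  "Leq s t \<equiv> Disj (Less s t) (Eq s t)"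

text \<open>
  In the schemes, the variable of \<open>\<phi>\<close> on which the induction runs has index 0 and all other
  indices are parameters. The formula \<open>\<phi>(v)\<close>, where \<open>v\<close> is the innermost bound variable
  and \<open>d\<close> further quantifiers lie outside it, is \<open>under d \<phi>\<close>: the parameters are
  shifted past those \<open>d\<close> quantifiers.
\<close>

definition under :: "nat \<Rightarrow> ('f, 'r) fm \<Rightarrow> ('f, 'r) fm" where
  "under d \<phi> = rename (case_nat 0 (\<lambda>k. Suc (k + d))) \<phi>"

definition dci_instance :: "('f, 'r) fm \<Rightarrow> ('f, 'r) fm" where
  "dci_instance \<phi> =
    Imp
      (Conj
        (Ex (All (Imp (Less (Var 0) (Var 1)) (under 1 \<phi>))))
        (All (Imp
          (All (Imp (Less (Var 0) (Var 1)) (under 1 \<phi>)))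
          (Ex (Conj (Less (Var 1) (Var 0))
                    (All (Imp (Less (Var 0) (Var 1)) (under 2 \<phi>))))))))
      (All (under 0 \<phi>))"

text \<open>In the second premise the quantifiers bind \<open>\<epsilon>\<close>, \<open>x\<close>, \<open>y\<close> in this order.\<close>

definition dci1_instance :: "('f, 'r) fm \<Rightarrow> ('f, 'r) fm" where
  "dci1_instance \<phi> =
    Imp
      (Conj
        (Ex (All (Imp (Leq (Var 0) (Var 1)) (under 1 \<phi>))))
        (Ex (Conj (Less Zero (Var 0))
          (All (Imp
            (under 1 \<phi>)
            (All (Imp
              (Conj (Leq (Var 1) (Var 0)) (Leq (Var 0) (Plus (Var 1) (Var 2))))
              (under 2 \<phi>))))))))
      (All (under 0 \<phi>))"

definition DCI :: "('f, 'r, 'z) language_scheme \<Rightarrow> ('f, 'r) fm set" where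
  "DCI L = {dci_instance \<phi> | \<phi>. fm_in L \<phi>}"

definition DCI\<^sub>1 :: "('f, 'r, 'z) language_scheme \<Rightarrow> ('f, 'r) fm set" where
  "DCI\<^sub>1 L = {dci1_instance \<phi> | \<phi>. fm_in L \<phi>}"

class divisible_linordered_ab_group = linordered_ab_group_add +
  assumes divisible: "0 < n \<Longrightarrow> \<exists>y. (\<Sum>i<(n::nat). y) = x"

instance rat :: divisible_linordered_ab_group
proof
  fix n :: nat and x :: rat
  assume "0 < n"
  then show "\<exists>y. (\<Sum>i<n. y) = x"
    by (intro exI[of _ "x / of_nat n"]) simp
qed

datatype field_sym = One | Uminus | Times

definition ordered_field_language :: "(field_sym, unit) language" where
  "ordered_field_language = \<lparr>fun_syms = {(One, 0), (Uminus, 1), (Times, 2)}, rel_syms = {}\<rparr>"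

fun field_fun :: "field_sym \<Rightarrow> 'a::linordered_field list \<Rightarrow> 'a" where
  "field_fun One [] = 1"
| "field_fun Uminus [x] = - x"
| "field_fun Times [x, y] = x * y"
| "field_fun _ _ = 0"

definition ordered_field_interp :: "(field_sym, unit, 'a::linordered_field) interp" where
  "ordered_field_interp = \<lparr>fun_of = field_fun, rel_of = (\<lambda>_ _. False)\<rparr>"

abbreviation rat_field :: "(field_sym, unit, rat) interp" where
  "rat_field \<equiv> ordered_field_interp"

end

theory Submission
  imports Defs
begin

text \<open>
  If \<open>\<phi>\<close> holds below \<open>x\<close> and propagates by steps of length \<open>\<epsilon>\<close>, then it propagates from
  \<open>x - \<epsilon>\<close> and from \<open>x - \<epsilon>/2\<close>, hence holds below \<open>x + \<epsilon>/2\<close>; so the premises of \<open>DCI\<^sub>1\<close> imply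
  those of \<open>DCI\<close>. In an Archimedean structure such as the rationals, the steps of length \<open>\<epsilon>\<close>
  reach every element, so \<open>DCI\<^sub>1\<close> holds, whereas the cut at the square root of 2 refutes \<open>DCI\<close>.
\<close>

lemma tm_val_rename_tm: "tm_val M e (rename_tm g t) = tm_val M (\<lambda>k. e (g k)) t"
proof (induction t)
  case (Fn f ts)
  then have "map (tm_val M e \<circ> rename_tm g) ts = map (tm_val M (\<lambda>k. e (g k))) ts"
    by simp
  then show ?case by (simp only: rename_tm.simps tm_val.simps list.map_comp)
qed simp_all

text \<open>This carries the induction for \<open>sat_rename\<close> through the quantifiers, where
  assignment and renaming change together.\<close>

lemma case_nat_lift_ren: "(\<lambda>k. case_nat a e (lift_ren g k)) = case_nat a (\<lambda>k. e (g k))"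
  by (rule ext) (simp split: nat.split)

lemma sat_rename: "sat M e (rename g p) \<longleftrightarrow> sat M (\<lambda>k. e (g k)) p"
proof (induction p arbitrary: e g)
  case (Rel r ts)
  have "map (tm_val M e \<circ> rename_tm g) ts = map (tm_val M (\<lambda>k. e (g k))) ts"
    by (simp add: tm_val_rename_tm)
  then show ?case by (simp only: rename.simps sat.simps list.map_comp)
qed (simp_all add: tm_val_rename_tm case_nat_lift_ren)

lemma sat_under:
  "sat M (case_nat v e) (under d \<phi>) \<longleftrightarrow> sat M (case_nat v (\<lambda>k. e (k + d))) \<phi>"
proof -
  have "(\<lambda>k. case_nat v e (case_nat 0 (\<lambda>k. Suc (k + d)) k)) = case_nat v (\<lambda>k. e (k + d))"
    by (rule ext) (simp split: nat.split)
  then show ?thesis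
    by (simp add: under_def sat_rename)
qed

text \<open>By \<open>sat_under\<close>, the shift in \<open>under\<close> skips exactly the values
  bound by the intermediate quantifiers, so the parameters keep their values from \<open>e\<close>
  throughout. From here on the schemes are statements about a predicate, free of de Bruijn
  indices.\<close>

lemma sat_dci_instance:
  defines "P \<equiv> \<lambda>M e \<phi> v. sat M (case_nat v e) \<phi>"
  shows "sat M e (dci_instance \<phi>) \<longleftrightarrow>
    ((\<exists>x. \<forall>y<x. P M e \<phi> y) \<and>
     (\<forall>x. (\<forall>y<x. P M e \<phi> y) \<longrightarrow> (\<exists>z>x. \<forall>y<z. P M e \<phi> y))
     \<longrightarrow> (\<forall>x. P M e \<phi> x))"
  by (simp add: dci_instance_def sat_under P_def)

lemma sat_dci1_instance:
  fixes M :: "('f, 'r, 'a::{zero,plus,order}) interp"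
  defines "P \<equiv> \<lambda>M e \<phi> v. sat M (case_nat v e) \<phi>"
  shows "sat M e (dci1_instance \<phi>) \<longleftrightarrow>
    ((\<exists>x. \<forall>y\<le>x. P M e \<phi> y) \<and>
     (\<exists>\<epsilon>>0. \<forall>x. P M e \<phi> x \<longrightarrow> (\<forall>y. x \<le> y \<and> y \<le> x + \<epsilon> \<longrightarrow> P M e \<phi> y))
     \<longrightarrow> (\<forall>x. P M e \<phi> x))"
  by (simp add: dci1_instance_def sat_under P_def order.order_iff_strict)

lemma positive_half:
  fixes \<epsilon> :: "'a::divisible_linordered_ab_group"
  assumes "0 < \<epsilon>"
  obtains h where "0 < h" "h + h = \<epsilon>"
proof -
  obtain h where "(\<Sum>i<(2::nat). h) = \<epsilon>"
    using divisible[of 2 \<epsilon>] by auto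
  then have "h + h = \<epsilon>"
    by (simp add: numeral_2_eq_2)
  moreover from this have "0 < h"
    using assms zero_less_double_add_iff_zero_less_single_add by blast
  ultimately show thesis by (rule that[rotated])
qed

text \<open>\<open>P\<close> is not known at \<open>x\<close> itself, so a step has to start
  strictly below \<open>x\<close> and still end beyond it. With \<open>h\<close> half of
  \<open>\<epsilon>\<close>, one step from \<open>x - h\<close> covers everything up to
  \<open>x + h\<close>.\<close>

lemma uniform_step_extends:
  fixes P :: "'a::divisible_linordered_ab_group \<Rightarrow> bool"
  assumes "0 < \<epsilon>"
    and step: "\<And>x y. P x \<Longrightarrow> x \<le> y \<Longrightarrow> y \<le> x + \<epsilon> \<Longrightarrow> P y"
    and below: "\<And>y. y < x \<Longrightarrow> P y"
  shows "\<exists>z>x. \<forall>y<z. P y"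
proof -
  obtain h where h: "0 < h" "h + h = \<epsilon>"
    using positive_half assms(1) by blast
  have "P y" if "y < x + h" for y
  proof (cases "y < x")
    case False
    show ?thesis
    proof (rule step)
      show "P (x - h)" using below h(1) by simp
      have "x - h \<le> x" using h(1) by simp
      then show "x - h \<le> y" using False by (meson not_less order.trans)
      have "x - h + \<epsilon> = x + h" by (simp flip: h(2) add: algebra_simps)
      then show "y \<le> x - h + \<epsilon>" using that by (simp only: less_imp_le)
    qed
  qed (rule below)
  moreover have "x < x + h" using h(1) by simp
  ultimately show ?thesis by blast
qed

lemma holds_DCI_imp_DCI1:
  fixes M :: "('f, 'r, 'a::divisible_linordered_ab_group) interp"
  assumes "holds M (DCI L)"
  shows "holds M (DCI\<^sub>1 L)"
proof -
  have "sat M e (dci1_instance \<phi>)" if "fm_in L \<phi>" for \<phi> e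
  proof -
    have dci: "sat M e (dci_instance \<phi>)"
      using assms that by (auto simp: holds_def DCI_def)
    show ?thesis
      unfolding sat_dci1_instance
    proof (intro impI, elim conjE exE)
      fix x \<epsilon>
      assume "\<forall>y\<le>x. sat M (case_nat y e) \<phi>" "0 < \<epsilon>"
        and "\<forall>x. sat M (case_nat x e) \<phi> \<longrightarrow>
          (\<forall>y. x \<le> y \<and> y \<le> x + \<epsilon> \<longrightarrow> sat M (case_nat y e) \<phi>)"
      then have "\<exists>x. \<forall>y<x. sat M (case_nat y e) \<phi>"
        and "(\<forall>y<x. sat M (case_nat y e) \<phi>) \<longrightarrow> (\<exists>z>x. \<forall>y<z. sat M (case_nat y e) \<phi>)" for x
        using uniform_step_extends[of \<epsilon> "\<lambda>v. sat M (case_nat v e) \<phi>" x]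
        by (blast intro: order.strict_implies_order)+
      then show "\<forall>x. sat M (case_nat x e) \<phi>"
        using dci unfolding sat_dci_instance by blast
    qed
  qed
  then show ?thesis
    by (auto simp: holds_def DCI\<^sub>1_def)
qed

lemma archimedean_step_induct:
  fixes P :: "'a::archimedean_field \<Rightarrow> bool"
  assumes base: "\<And>y. y \<le> a \<Longrightarrow> P y"
    and "0 < \<epsilon>"
    and step: "\<And>x y. P x \<Longrightarrow> x \<le> y \<Longrightarrow> y \<le> x + \<epsilon> \<Longrightarrow> P y"
  shows "P x"
proof -
  have *: "P y" if "y \<le> a + of_nat n * \<epsilon>" for n y
    using that
  proof (induction n arbitrary: y)
    case 0
    then show ?case using base by simp
  next
    case (Suc n)
    show ?case
    proof (rule step)
      \<comment> \<open>The step ends exactly at \<open>y\<close>: going back by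
        \<open>\<epsilon>\<close> lands within the bound of the induction hypothesis.\<close>
      show "P (y - \<epsilon>)" using Suc by (simp add: algebra_simps)
    qed (use \<open>0 < \<epsilon>\<close> in simp_all)
  qed
  obtain n where "x - a < of_nat n * \<epsilon>"
    using ex_less_of_nat_mult[OF \<open>0 < \<epsilon>\<close>] by blast
  then show ?thesis using *[of x n] by simp
qed

lemma archimedean_holds_DCI1:
  fixes M :: "('f, 'r, 'a::archimedean_field) interp"
  shows "holds M (DCI\<^sub>1 L)"
proof -
  have "sat M e (dci1_instance \<phi>)" for \<phi> e
    unfolding sat_dci1_instance
    using archimedean_step_induct[where P = "\<lambda>v. sat M (case_nat v e) \<phi>"] by blast
  then show ?thesis
    by (auto simp: holds_def DCI\<^sub>1_def)
qed

text \<open>The classical parity argument: numerator and denominator of a fraction in lowest terms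
  would both be even.\<close>

lemma rat_square_neq_2: "x * x \<noteq> 2" for x :: rat
proof
  assume x: "x * x = 2"
  obtain a b where ab: "quotient_of x = (a, b)" by fastforce
  have "b > 0" and cop: "coprime a b" and "x = of_int a / of_int b"
    using ab quotient_of_denom_pos quotient_of_coprime quotient_of_div by blast+
  then have "of_int a = x * of_int b" by simp
  then have "of_int (a * a) = x * x * (of_int (b * b) :: rat)" by simp
  then have "of_int (a * a) = (of_int (2 * (b * b)) :: rat)" by (simp add: x)
  then have eq: "a * a = 2 * (b * b)" by (simp only: of_int_eq_iff)
  then have "even (a * a)" by simp
  then have "even a" by simp
  then obtain c where "a = 2 * c" ..
  with eq have "b * b = 2 * (c * c)" by simp
  then have "even (b * b)" by simp
  then have "even b" by simp
  with \<open>even a\<close> cop show False by auto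
qed

text \<open>
  The map \<open>x \<mapsto> (2x + 2) / (x + 2)\<close> moves every nonnegative \<open>x\<close> strictly towards the square
  root of 2 without passing it.
\<close>

lemma sqrt2_approx:
  fixes x :: "'a::linordered_field"
  assumes "0 \<le> x"
  defines "z \<equiv> (2 * x + 2) / (x + 2)"
  shows "0 < z" "z - x = (2 - x * x) / (x + 2)" "z * z - 2 = 2 * (x * x - 2) / ((x + 2) * (x + 2))"
proof -
  have "x + 2 > 0" using assms(1) by simp
  then have "x + 2 \<noteq> 0" by simp
  show "0 < z" using \<open>x + 2 > 0\<close> assms(1) by (simp add: z_def)
  show "z - x = (2 - x * x) / (x + 2)"
    using \<open>x + 2 \<noteq> 0\<close> by (simp add: z_def divide_simps) (simp add: algebra_simps)
  show "z * z - 2 = 2 * (x * x - 2) / ((x + 2) * (x + 2))"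
    using \<open>x + 2 \<noteq> 0\<close> by (simp add: z_def divide_simps) (simp add: algebra_simps)
qed

text \<open>The predicate describes the lower part of the cut at the square root of 2, which has no
  rational supremum.\<close>

lemma sqrt2_cut_extends:
  fixes x :: rat
  assumes "\<And>y. y < x \<Longrightarrow> y < 0 \<or> y * y < 2"
  shows "\<exists>z>x. \<forall>y<z. y < 0 \<or> y * y < 2"
proof (cases "x < 0")
  case True
  \<comment> \<open>The witness is 0.\<close>
  then show ?thesis by blast
next
  case False
  then have "0 \<le> x" "0 < x + 2" by simp_all
  define z where "z = (2 * x + 2) / (x + 2)"
  note z = sqrt2_approx[OF \<open>0 \<le> x\<close>, folded z_def]
  have "\<not> 2 < x * x"
  proof
    \<comment> \<open>Here \<open>z\<close> is a positive element below \<open>x\<close> whose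
      square still exceeds 2, against the assumption.\<close>
    assume "2 < x * x"
    then have "z - x < 0" "z * z - 2 > 0"
      unfolding z(2,3) using \<open>0 < x + 2\<close> by (auto intro: divide_neg_pos divide_pos_pos)
    then show False using assms[of z] z(1) by auto
  qed
  then have "x * x < 2" using rat_square_neq_2[of x] by simp
  \<comment> \<open>Now \<open>z\<close> lies beyond \<open>x\<close> and its square is still below
    2, so it serves as the witness.\<close>
  then have "z - x > 0" "z * z - 2 < 0"
    unfolding z(2,3) using \<open>0 < x + 2\<close> by (auto intro: divide_neg_pos divide_pos_pos)
  moreover have "y * y \<le> z * z" if "y < z" "\<not> y < 0" for y
    using that by (intro mult_mono) auto
  ultimately show ?thesis by (intro exI[of _ z]) force
qed

lemma rat_not_holds_DCI: "\<not> holds rat_field (DCI ordered_field_language)"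
proof
  \<comment> \<open>The cut as a formula without parameters; the number 2 is written as 1 +
    1.\<close>
  define \<phi> :: "(field_sym, unit) fm" where
    "\<phi> = Disj (Less (Var 0) Zero)
      (Less (Fn Times [Var 0, Var 0]) (Plus (Fn One []) (Fn One [])))"
  have sat: "sat rat_field (case_nat v e) \<phi> \<longleftrightarrow> v < 0 \<or> v * v < 2" for v e
    by (simp add: \<phi>_def ordered_field_interp_def)
  have "fm_in ordered_field_language \<phi>"
    by (simp add: \<phi>_def ordered_field_language_def)
  moreover assume "holds rat_field (DCI ordered_field_language)"
  ultimately have "sat rat_field (\<lambda>_. 0) (dci_instance \<phi>)"
    by (auto simp: holds_def DCI_def)
  moreover have "\<exists>x. \<forall>y<x. y < 0 \<or> y * y < (2::rat)" by blast
  ultimately have "\<forall>x. x < 0 \<or> x * x < (2::rat)"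
    unfolding sat_dci_instance sat using sqrt2_cut_extends by blast
  \<comment> \<open>The element 2 lies above the cut, since its square is 4.\<close>
  from spec[OF this, of 2] show False by simp
qed

theorem theorem2p8:
  fixes L :: "('f, 'r) language"
    and M :: "('f, 'r, 'a::divisible_linordered_ab_group) interp"
  shows "(holds M (DCI L) \<longrightarrow> holds M (DCI\<^sub>1 L))
    \<and> holds rat_field (DCI\<^sub>1 ordered_field_language)
    \<and> \<not> holds rat_field (DCI ordered_field_language)"
  using holds_DCI_imp_DCI1 archimedean_holds_DCI1 rat_not_holds_DCI by blast

end
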